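(* Let $(\mathbb{R}^{2n},\omega)$ be the standard symplectic vector space with linear symplectic group $\mathrm{Sp}(n)$, let $R=\begin{pmatrix}\mathbb{1}&0\\0&-\mathbb{1}\end{pmatrix}$ with respect to the splitting $\mathbb{R}^{2n}=\mathbb{R}^n\oplus\mathbb{R}^n$, and let $\mathrm{Sp}^R(n)=\{\psi\in\mathrm{Sp}(n)\mid \psi=R\psi^{-1}R\}$. Then for every $\phi\in\mathrm{Sp}(n)$ there exists $\psi\in\mathrm{Sp}(n)$ with $\psi\phi\psi^{-1}\in\mathrm{Sp}^R(n)$.
   Context: $\omega$ is the standard symplectic form on $\mathbb{R}^{2n}=\mathbb{R}^n\oplus\mathbb{R}^n$, for which both factors are Lagrangian (standard splitting $\mathbb{R}^{2n}\cong T^*\mathbb{R}^n$); $\mathrm{Sp}(n)$ is the group of linear maps of $\mathbb{R}^{2n}$ preserving $\omega$. *)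

theory Defs
  imports "HOL-Analysis.Analysis"
begin

text \<open>We model R^{2n} = R^n (+) R^n as real^('n + 'n): coordinates Inl i are the
  first factor (q-coordinates), Inr i the second factor (p-coordinates).\<close>

definition omega :: "real ^ ('n::finite + 'n) \<Rightarrow> real ^ ('n + 'n) \<Rightarrow> real" where
  "omega x y = (\<Sum>i\<in>UNIV. x $ Inl i * y $ Inr i - x $ Inr i * y $ Inl i)"

definition Sp :: "(real ^ ('n::finite + 'n) ^ ('n + 'n)) set" where
  "Sp = {A. \<forall>x y. omega (A *v x) (A *v y) = omega x y}"

definition Rmat :: "real ^ ('n::finite + 'n) ^ ('n + 'n)" where
  "Rmat = (\<chi> a b. if a = b then (case a of Inl _ \<Rightarrow> 1 | Inr _ \<Rightarrow> -1) else 0)"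

definition SpR :: "(real ^ ('n::finite + 'n) ^ ('n + 'n)) set" where
  "SpR = {\<psi> \<in> Sp. \<psi> = Rmat ** matrix_inv \<psi> ** Rmat}"

end

theory Submission
  imports Defs "HOL-Computational_Algebra.Polynomial_Factorial"
    "HOL-Computational_Algebra.Field_as_Ring"
begin

text \<open>
  It suffices to find an antisymplectic involution \<open>S\<close> with \<open>S \<phi> S = \<phi>\<^sup>-\<^sup>1\<close>: a basis of its
  \<open>+1\<close>-eigenspace and the dual basis of its \<open>-1\<close>-eigenspace form a symplectic basis in which \<open>S\<close>
  is the matrix \<open>R\<close>. Splitting off orthogonal summands, one may assume that the space has no
  proper nondegenerate invariant subspace. The operator \<open>T = \<phi> + \<phi>\<^sup>-\<^sup>1\<close> is self-adjoint, so by
  Fitting's lemma some irreducible polynomial \<open>p\<close> satisfies \<open>p(T)^(k+1) = 0 \<noteq> p(T)^k\<close>. The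
  operator \<open>N = \<phi> - \<phi>\<^sup>-\<^sup>1\<close> is anti-self-adjoint and \<open>N\<^sup>2 = T\<^sup>2 - 4\<close>.

  If \<open>\<omega>(x, p(T)^k N x) \<noteq> 0\<close> for some \<open>x\<close>, then \<open>x\<close> generates the space over \<open>\<real>[T, N]\<close>, and \<open>S\<close>
  fixes \<open>x\<close>, commutes with \<open>T\<close> and anticommutes with \<open>N\<close>. Otherwise \<open>p(T)^k N = 0\<close>, which forces
  \<open>p = X \<mp> 2\<close>; then the space is generated by some \<open>x\<close> and a dual vector \<open>y\<close> orthogonal to
  \<open>\<real>[T] N x\<close>, and \<open>S\<close> fixes \<open>x\<close> and negates \<open>y\<close>.
\<close>

section \<open>Real polynomials acting through a linear operator, by Horner's scheme\<close>

definition poly_act :: "('a::real_vector \<Rightarrow> 'a) \<Rightarrow> real poly \<Rightarrow> 'a \<Rightarrow> 'a" where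
  "poly_act f p x = fold_coeffs (\<lambda>a y. a *\<^sub>R x + f y) p 0"

context
  fixes f :: "'a::real_vector \<Rightarrow> 'a"
  assumes lin: "linear f"
begin

lemma poly_act_0 [simp]: "poly_act f 0 x = 0"
  by (simp add: poly_act_def)

lemma poly_act_pCons [simp]: "poly_act f (pCons a p) x = a *\<^sub>R x + f (poly_act f p x)"
proof (cases "a = 0 \<and> p = 0")
  case True
  then show ?thesis using linear_0[OF lin] by (simp add: poly_act_def)
next
  case False
  then show ?thesis by (auto simp: poly_act_def)
qed

lemma poly_act_add: "poly_act f (p + q) x = poly_act f p x + poly_act f q x"
proof (induction p arbitrary: q)
  case 0
  then show ?case by simp
next
  case (pCons a p)
  obtain b r where "q = pCons b r" by (rule pCons_cases)
  then show ?case
    by (simp add: pCons.IH linear_add[OF lin] algebra_simps)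
qed

lemma poly_act_smult: "poly_act f (smult c p) x = c *\<^sub>R poly_act f p x"
  by (induction p) (simp_all add: linear_cmul[OF lin] algebra_simps)

lemma poly_act_minus: "poly_act f (- p) x = - poly_act f p x"
  using poly_act_smult[of "-1" p x] by simp

lemma poly_act_diff: "poly_act f (p - q) x = poly_act f p x - poly_act f q x"
  using poly_act_add[of p "- q" x] by (simp add: poly_act_minus)

lemma poly_act_mult: "poly_act f (p * q) x = poly_act f p (poly_act f q x)"
proof (induction p)
  case 0
  then show ?case by simp
next
  case (pCons a p)
  then show ?case
    by (simp add: poly_act_add poly_act_smult)
qed

lemma poly_act_one: "poly_act f 1 x = x"
  using linear_0[OF lin] by (simp add: one_pCons)

lemma poly_act_monom: "poly_act f (monom c n) x = c *\<^sub>R (f ^^ n) x"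
proof (induction n)
  case 0
  then show ?case using linear_0[OF lin] by (simp add: monom_0)
next
  case (Suc n)
  then show ?case by (simp add: monom_Suc linear_cmul[OF lin])
qed

lemma poly_act_sum: "poly_act f (sum P A) x = (\<Sum>i\<in>A. poly_act f (P i) x)"
  by (induction A rule: infinite_finite_induct) (simp_all add: poly_act_add)

lemma poly_act_commute:
  assumes "linear g" and "\<And>x. g (f x) = f (g x)"
  shows "g (poly_act f p x) = poly_act f p (g x)"
  by (induction p)
    (simp_all add: linear_0[OF assms(1)] linear_add[OF assms(1)] linear_cmul[OF assms(1)] assms(2))

lemma poly_act_linear: "linear (poly_act f p)"
proof (induction p)
  case 0
  then show ?case by (simp add: linear_iff)
next
  case (pCons a p)
  then show ?case using lin by (simp add: linear_iff algebra_simps)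
qed

lemma poly_act_in_subspace:
  assumes "subspace U" and "\<And>x. x \<in> U \<Longrightarrow> f x \<in> U" and "x \<in> U"
  shows "poly_act f p x \<in> U"
  using assms by (induction p) (auto simp: subspace_0 subspace_add subspace_scale)

end

text \<open>More than \<open>DIM('a)\<close> iterates of \<open>x\<close> satisfy a linear relation,
  and its coefficients form \<open>q\<close>. Coinciding iterates are treated apart because their
  relation disappears once they are collected into a set.\<close>

lemma exists_annihilating_poly:
  fixes f :: "'a::euclidean_space \<Rightarrow> 'a"
  assumes lin: "linear f"
  shows "\<exists>q. q \<noteq> 0 \<and> poly_act f q x = 0"
proof (cases "inj_on (\<lambda>i. (f ^^ i) x) {..DIM('a)}")
  case False
  then obtain i j where "i < j" "(f ^^ i) x = (f ^^ j) x"
    unfolding inj_on_def by (metis linorder_neqE_nat)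
  moreover from this have "monom 1 i - monom 1 j \<noteq> (0 :: real poly)"
    by (simp add: monom_eq_iff')
  ultimately show ?thesis
    by (intro exI[of _ "monom 1 i - monom 1 j"]) (simp add: poly_act_diff poly_act_monom lin)
next
  case inj: True
  let ?v = "\<lambda>i. (f ^^ i) x"
  have "card (?v ` {..DIM('a)}) = DIM('a) + 1"
    using inj by (simp add: card_image)
  then have "dependent (?v ` {..DIM('a)})"
    by (intro dependent_biggerset) simp
  then obtain u w where w: "w \<in> ?v ` {..DIM('a)}" "u w \<noteq> 0"
    and sum0: "(\<Sum>v\<in>?v ` {..DIM('a)}. u v *\<^sub>R v) = 0"
    by (auto simp: dependent_finite)
  define q where "q = (\<Sum>i\<le>DIM('a). monom (u (?v i)) i)"
  obtain i where i: "i \<le> DIM('a)" "w = ?v i" using w(1) by auto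
  have "coeff q i = u w"
    using i by (simp add: q_def coeff_sum)
  then have "q \<noteq> 0" using w(2) by auto
  moreover have "poly_act f q x = 0"
    using sum0 by (simp add: q_def poly_act_sum poly_act_monom lin sum.reindex[OF inj])
  ultimately show ?thesis by blast
qed

section \<open>Alternating forms, Riesz representation and maps reversing the form\<close>

definition nondegenerate_on :: "('a \<Rightarrow> 'a \<Rightarrow> real) \<Rightarrow> 'a::zero set \<Rightarrow> bool" where
  "nondegenerate_on w U \<longleftrightarrow> (\<forall>x\<in>U. (\<forall>y\<in>U. w x y = 0) \<longrightarrow> x = 0)"

lemma nondegenerate_onD:
  "nondegenerate_on w U \<Longrightarrow> x \<in> U \<Longrightarrow> (\<And>y. y \<in> U \<Longrightarrow> w x y = 0) \<Longrightarrow> x = 0"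
  by (auto simp: nondegenerate_on_def)

locale alternating_form =
  fixes w :: "'a::euclidean_space \<Rightarrow> 'a \<Rightarrow> real"
  assumes bilinear: "bilinear w"
    and skew: "w x y = - w y x"
begin

lemmas w_simps = bilinear_ladd[OF bilinear] bilinear_radd[OF bilinear]
  bilinear_lmul[OF bilinear] bilinear_rmul[OF bilinear]
  bilinear_lneg[OF bilinear] bilinear_rneg[OF bilinear]
  bilinear_lsub[OF bilinear] bilinear_rsub[OF bilinear]
  bilinear_lzero[OF bilinear] bilinear_rzero[OF bilinear]

lemma w_zero_span:
  assumes "z \<in> span B" and "\<And>b. b \<in> B \<Longrightarrow> w b y = 0"
  shows "w z y = 0"
  using assms by (induction rule: span_induct_alt) (auto simp: w_simps)

text \<open>Riesz representation with \<open>w\<close> in place of an inner product. For a basis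
  \<open>B\<close> of \<open>U\<close>, the map \<open>L\<close> recording the values
  \<open>w b y\<close> is injective on \<open>U\<close> by nondegeneracy and maps \<open>U\<close>
  into itself, so it is onto; a preimage of the vector recording the values \<open>l b\<close>
  represents \<open>l\<close>.\<close>

lemma riesz_on:
  assumes U: "subspace U" "nondegenerate_on w U" and l: "linear l"
  shows "\<exists>y\<in>U. \<forall>z\<in>U. w z y = l z"
proof -
  obtain B where B: "B \<subseteq> U" "independent B" "U \<subseteq> span B" "finite B"
    by (metis basis_exists finiteI_independent)
  have spanB: "span B = U" using B U by (metis span_minimal subset_antisym)
  define L where "L y = (\<Sum>b\<in>B. w b y *\<^sub>R b)" for y
  have L: "linear L"
    by (auto simp: L_def linear_iff w_simps sum.distrib scaleR_sum_right scaleR_left_distrib)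
  have LU: "L ` U \<subseteq> U"
    using U(1) B(1) by (auto simp: L_def intro!: subspace_sum subspace_scale)
  have "inj_on L U"
  proof (subst linear_inj_on_iff_eq_0[OF L U(1)], intro ballI impI)
    fix y assume y: "y \<in> U" "L y = 0"
    have "w b y = 0" if "b \<in> B" for b
      using y(2) that B(2,4) independentD[of B B "\<lambda>b. w b y"] by (auto simp: L_def)
    then have "w y z = 0" if "z \<in> U" for z
      using w_zero_span[of z B y] that spanB skew[of y z] by auto
    then show "y = 0" using U(2) y(1) by (auto simp: nondegenerate_on_def)
  qed
  then have "dim (L ` U) = dim U"
    using L U(1) by (intro dim_image_eq) (simp_all add: span_eq_iff[THEN iffD2])
  then have "L ` U = U"
    using LU U(1) L by (intro subspace_dim_equal) (auto simp: linear_subspace_image)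
  moreover have "(\<Sum>b\<in>B. l b *\<^sub>R b) \<in> U"
    using U(1) B(1) by (auto intro!: subspace_sum subspace_scale)
  ultimately obtain y where y: "y \<in> U" "L y = (\<Sum>b\<in>B. l b *\<^sub>R b)" by (metis imageE)
  have "w b y = l b" if "b \<in> B" for b
  proof -
    have "(\<Sum>b\<in>B. (w b y - l b) *\<^sub>R b) = 0"
      using y(2) by (simp add: L_def scaleR_left_diff_distrib sum_subtractf)
    then show ?thesis
      using that B(2,4) independentD[of B B "\<lambda>b. w b y - l b"] by auto
  qed
  moreover have "linear (\<lambda>z. w z y)" by (auto simp: linear_iff w_simps)
  ultimately have "w z y = l z" if "z \<in> U" for z
    using linear_eq_on_span[OF _ l, of "\<lambda>z. w z y" B z] that spanB by auto
  then show ?thesis using y(1) by blast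
qed

text \<open>A relation that reverses the sign of the form is automatically the graph of a linear map
  as soon as its domain and its range span and the form is nondegenerate.\<close>

lemma antisymplectic_relation_extends:
  assumes nd: "nondegenerate_on w U" and U: "subspace U"
    and fst: "span (fst ` G) = U" and snd: "span (snd ` G) = U"
    and anti: "\<And>v v' u u'. (v, u) \<in> G \<Longrightarrow> (v', u') \<in> G \<Longrightarrow> w u u' = - w v v'"
  shows "\<exists>S. linear S \<and> (\<forall>(v, u)\<in>G. S v = u)"
proof -
  obtain B where B: "B \<subseteq> fst ` G" "independent B" "fst ` G \<subseteq> span B"
    using maximal_independent_subset by blast
  have spanB: "span B = U"
    using span_mono[OF B(1)] span_minimal[OF B(3) subspace_span] unfolding fst
    by (rule subset_antisym)
  define g where "g b = (SOME u. (b, u) \<in> G)" for b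
  have g: "(b, g b) \<in> G" if "b \<in> B" for b
  proof -
    have "b \<in> fst ` G" using B(1) that by blast
    then have "\<exists>u. (b, u) \<in> G" by force
    then show ?thesis unfolding g_def by (rule someI_ex)
  qed
  obtain S where S: "linear S" "\<And>b. b \<in> B \<Longrightarrow> S b = g b"
    using linear_independent_extend[OF B(2), of g] by blast
  have SU: "S z \<in> U" if "z \<in> U" for z
  proof -
    have "S z \<in> span (S ` B)" using that spanB linear_span_image[OF S(1), of B] by auto
    moreover have "S ` B \<subseteq> snd ` G" using S(2) g by force
    ultimately show ?thesis using snd span_mono by blast
  qed
  \<comment> \<open>\<open>S\<close> comes from an arbitrary choice on the basis, yet its pairing
    with every second component is already determined.\<close>
  have pair: "w (S z) u = - w z v" if "z \<in> U" "(v, u) \<in> G" for z v u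
  proof -
    have "z \<in> span B" using that spanB by simp
    then show ?thesis
    proof (induction rule: span_induct_alt)
      case base
      then show ?case using linear_0[OF S(1)] by (simp add: w_simps)
    next
      case (step c b z)
      have "w (S b) u = - w b v" using anti[OF g[OF step(1)] that(2)] S(2)[OF step(1)] by simp
      then show ?case using step
        by (simp add: w_simps linear_add[OF S(1)] linear_cmul[OF S(1)])
    qed
  qed
  have "S v = u" if vu: "(v, u) \<in> G" for v u
  proof -
    have vU: "v \<in> U" "u \<in> U" using vu fst snd by (force intro: span_base)+
    \<comment> \<open>The second components span \<open>U\<close> and pair with \<open>S v\<close>
      exactly as with \<open>u\<close>, so the choice made by \<open>g\<close> is
      immaterial.\<close>
    have "w (S v - u) z = 0" if "z \<in> U" for z
    proof -
      have "w b (S v - u) = 0" if b: "b \<in> snd ` G" for b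
      proof -
        obtain a where a: "(a, b) \<in> G" using b by auto
        have "w (S v) b = w u b" using pair[OF vU(1) a] anti[OF vu a] by simp
        then show ?thesis using skew[of b] by (simp add: w_simps)
      qed
      then have "w z (S v - u) = 0" using w_zero_span that snd by blast
      then show ?thesis using skew[of "S v - u" z] by simp
    qed
    then have "S v - u = 0" using nd vU SU U
      by (intro nondegenerate_onD[OF nd]) (auto intro: subspace_diff)
    then show ?thesis by simp
  qed
  then show ?thesis using S(1) by blast
qed

end

section \<open>Symplectic maps and their reversing involutions\<close>

locale symplectic_map = alternating_form w for w :: "'a::euclidean_space \<Rightarrow> 'a \<Rightarrow> real" +
  fixes f g :: "'a \<Rightarrow> 'a"
  assumes f_linear: "linear f" and g_linear: "linear g"
    and fg [simp]: "f (g x) = x" and gf [simp]: "g (f x) = x"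
    and f_symplectic: "w (f x) (f y) = w x y"
begin

definition invariant :: "'a set \<Rightarrow> bool" where
  "invariant U \<longleftrightarrow> subspace U \<and> (\<forall>x\<in>U. f x \<in> U \<and> g x \<in> U)"

text \<open>The coordinate-free counterpart of \<open>SpR\<close>, with \<open>S\<close> in the role
  of \<open>Rmat\<close>. Linearity is global but all other conditions are local to
  \<open>U\<close>, so that involutions of different summands can be found separately.\<close>

definition reversible_on :: "'a set \<Rightarrow> bool" where
  "reversible_on U \<longleftrightarrow> (\<exists>S. linear S \<and>
     (\<forall>x\<in>U. S x \<in> U \<and> S (S x) = x \<and> S (f x) = g (S x)) \<and>
     (\<forall>x\<in>U. \<forall>y\<in>U. w (S x) (S y) = - w x y))"

lemma w_f_left: "w (f x) y = w x (g y)"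
  using f_symplectic[of x "g y"] by simp

lemma w_g_left: "w (g x) y = w x (f y)"
  using f_symplectic[of "g x" y] by simp

text \<open>Describes the involution by pairs \<open>(v, S v)\<close> whose first components may be
  linearly dependent. Consistency comes from \<open>antisymplectic_relation_extends\<close>;
  symmetry of \<open>G\<close> gives \<open>S (S x) = x\<close>, closure under \<open>(f, g)\<close>
  gives the conjugation of \<open>f\<close> to \<open>g\<close>, and linearity carries both to the
  span.\<close>

lemma reversible_on_relation:
  assumes inv: "invariant U" and nd: "nondegenerate_on w U" and span: "span (fst ` G) = U"
    and anti: "\<And>v v' u u'. (v, u) \<in> G \<Longrightarrow> (v', u') \<in> G \<Longrightarrow> w u u' = - w v v'"
    and sym: "\<And>v u. (v, u) \<in> G \<Longrightarrow> (u, v) \<in> G"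
    and step: "\<And>v u. (v, u) \<in> G \<Longrightarrow> (f v, g u) \<in> G"
  shows "reversible_on U"
proof -
  have U: "subspace U" using inv by (simp add: invariant_def)
  have sndG: "snd ` G = fst ` G" using sym by force
  have span': "span (snd ` G) = U" unfolding sndG by (rule span)
  obtain S where S: "linear S" and "\<forall>(v, u)\<in>G. S v = u"
    using antisymplectic_relation_extends[OF nd U span span' anti] by blast
  then have SG: "S v = u" if "(v, u) \<in> G" for v u using that by auto
  note lin = linear_0[OF S] linear_add[OF S] linear_cmul[OF S]
    linear_0[OF f_linear] linear_add[OF f_linear] linear_cmul[OF f_linear]
    linear_0[OF g_linear] linear_add[OF g_linear] linear_cmul[OF g_linear]
  have G_U: "v \<in> U" if "v \<in> fst ` G" for v
    using span_base[OF that] unfolding span .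
  have one: "S x \<in> U \<and> S (S x) = x \<and> S (f x) = g (S x)" if "x \<in> U" for x
  proof -
    have "x \<in> span (fst ` G)" using that span by simp
    then show ?thesis
    proof (induction rule: span_induct_alt)
      case base
      then show ?case using U by (simp add: lin subspace_0)
    next
      case (step c v z)
      then obtain u where vu: "(v, u) \<in> G" by auto
      have "S v = u" "S u = v" "S (f v) = g u" using SG vu sym assms(6) by blast+
      moreover have "u \<in> U" using G_U sym[OF vu] by force
      ultimately show ?case using step U
        by (simp add: lin subspace_add subspace_scale)
    qed
  qed
  have two: "w (S x) (S y) = - w x y" if "x \<in> U" "y \<in> U" for x y
  proof -
    have x: "x \<in> span (fst ` G)" and y: "y \<in> span (fst ` G)" using that span by auto
    have aux: "w (S x) (S v) = - w x v" if v: "v \<in> fst ` G" for v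
      using x
    proof (induction rule: span_induct_alt)
      case base
      then show ?case by (simp add: lin w_simps)
    next
      case (step c a z)
      have "w (S a) (S v) = - w a v"
        using v step(1) SG anti by fastforce
      then show ?case using step by (simp add: lin w_simps)
    qed
    show ?thesis using y
    proof (induction rule: span_induct_alt)
      case base
      then show ?case by (simp add: lin w_simps)
    next
      case (step c a z)
      then show ?case using aux[of a] by (simp add: lin w_simps)
    qed
  qed
  show ?thesis unfolding reversible_on_def using S one two by blast
qed

text \<open>The orthogonal complement \<open>L\<close> of \<open>K\<close> in \<open>U\<close> is
  again invariant and nondegenerate. The involutions of \<open>K\<close> and \<open>L\<close> glue
  together because all cross terms of the form vanish.\<close>

lemma reversible_on_orthogonal_split:
  assumes inv: "invariant U" and nd: "nondegenerate_on w U"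
    and K: "invariant K" "nondegenerate_on w K" "K \<subseteq> U" "reversible_on K"
    and rest: "\<And>L. invariant L \<Longrightarrow> nondegenerate_on w L \<Longrightarrow> L \<subseteq> U \<Longrightarrow> K \<inter> L = {0} \<Longrightarrow> reversible_on L"
  shows "reversible_on U"
proof -
  have U: "subspace U" and Ks: "subspace K" using inv K by (auto simp: invariant_def)
  define L where "L = {x\<in>U. \<forall>z\<in>K. w z x = 0}"
  have L: "invariant L"
    unfolding invariant_def
  proof (intro conjI ballI)
    show "subspace L"
      using U by (auto simp: L_def subspace_def w_simps)
    fix x assume x: "x \<in> L"
    show "f x \<in> L" "g x \<in> L"
      using x inv K(1) by (auto simp: L_def invariant_def w_g_left[symmetric] w_f_left[symmetric])
  qed
  then have Ls: "subspace L" by (simp add: invariant_def)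
  \<comment> \<open>The vector \<open>y\<close> is the orthogonal projection of \<open>u\<close> to
    \<open>K\<close>, obtained by representing the functional \<open>w z u\<close> of
    \<open>z\<close> on \<open>K\<close>.\<close>
  have split: "\<exists>y\<in>K. u - y \<in> L" if "u \<in> U" for u
  proof -
    have "linear (\<lambda>z. w z u)" by (auto simp: linear_iff w_simps)
    then obtain y where "y \<in> K" "\<And>z. z \<in> K \<Longrightarrow> w z y = w z u"
      using riesz_on[OF Ks K(2)] by blast
    then show ?thesis using that K(3) U
      by (intro bexI[of _ y]) (auto simp: L_def w_simps subspace_diff)
  qed
  have KL: "K \<inter> L = {0}"
  proof -
    have "x = 0" if "x \<in> K" "x \<in> L" for x
      using that skew[of x] by (intro nondegenerate_onD[OF K(2)]) (auto simp: L_def)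
    then show ?thesis using subspace_0 Ks Ls by auto
  qed
  have ndL: "nondegenerate_on w L"
    unfolding nondegenerate_on_def
  proof (intro ballI impI)
    fix x assume x: "x \<in> L" and orth: "\<forall>y\<in>L. w x y = 0"
    have "w x u = 0" if u: "u \<in> U" for u
    proof -
      obtain y where y: "y \<in> K" "u - y \<in> L" using split u by blast
      then have "w y x = 0" using x by (simp add: L_def)
      then have "w x y = 0" using skew[of x y] by simp
      moreover have "w x (u - y) = 0" using orth y by blast
      ultimately show ?thesis by (simp add: w_simps)
    qed
    then show "x = 0" using nd x by (auto simp: L_def nondegenerate_on_def)
  qed
  obtain S1 where S1: "linear S1" "\<And>x. x \<in> K \<Longrightarrow> S1 x \<in> K \<and> S1 (S1 x) = x \<and> S1 (f x) = g (S1 x)"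
    "\<And>x y. x \<in> K \<Longrightarrow> y \<in> K \<Longrightarrow> w (S1 x) (S1 y) = - w x y"
    using K(4) unfolding reversible_on_def by blast
  obtain S2 where S2: "linear S2" "\<And>x. x \<in> L \<Longrightarrow> S2 x \<in> L \<and> S2 (S2 x) = x \<and> S2 (f x) = g (S2 x)"
    "\<And>x y. x \<in> L \<Longrightarrow> y \<in> L \<Longrightarrow> w (S2 x) (S2 y) = - w x y"
    using rest[OF L ndL _ KL] unfolding reversible_on_def L_def by blast
  have orth: "w z x = 0" "w x z = 0" if "z \<in> K" "x \<in> L" for x z
    using that skew[of x z] by (auto simp: L_def)
  define G where "G = (\<lambda>x. (x, S1 x)) ` K \<union> (\<lambda>x. (x, S2 x)) ` L"
  have fstG: "fst ` G = K \<union> L" by (force simp: G_def)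
  show ?thesis
  proof (rule reversible_on_relation[OF inv nd, of G])
    have "u \<in> span (K \<union> L)" if u: "u \<in> U" for u
    proof -
      obtain y where y: "y \<in> K" "u - y \<in> L" using split u by blast
      then have "y + (u - y) \<in> span (K \<union> L)" by (intro span_add span_base) auto
      then show ?thesis by simp
    qed
    moreover have "span (K \<union> L) \<subseteq> U"
      using K(3) U by (intro span_minimal) (auto simp: L_def)
    ultimately show "span (fst ` G) = U" using fstG by auto
  next
    fix v v' u u' assume "(v, u) \<in> G" "(v', u') \<in> G"
    then consider "v \<in> K" "u = S1 v" "v' \<in> K" "u' = S1 v'" | "v \<in> L" "u = S2 v" "v' \<in> L" "u' = S2 v'"
      | "v \<in> K" "u = S1 v" "v' \<in> L" "u' = S2 v'" | "v \<in> L" "u = S2 v" "v' \<in> K" "u' = S1 v'"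
      by (auto simp: G_def)
    then show "w u u' = - w v v'"
      by cases (simp_all add: S1(2,3) S2(2,3) orth)
  next
    fix v u assume "(v, u) \<in> G"
    then consider "v \<in> K" "u = S1 v" | "v \<in> L" "u = S2 v" by (auto simp: G_def)
    then show "(u, v) \<in> G" "(f v, g u) \<in> G"
      using K(1) L by (cases; simp add: G_def invariant_def image_iff; metis S1(2) S2(2))+
  qed
qed

section \<open>The self-adjoint operator \<open>T\<close> and the anti-self-adjoint operator
  \<open>N\<close>\<close>

definition T :: "'a \<Rightarrow> 'a" where "T x = f x + g x"
definition N :: "'a \<Rightarrow> 'a" where "N x = f x - g x"

abbreviation pT :: "real poly \<Rightarrow> 'a \<Rightarrow> 'a" where "pT \<equiv> poly_act T"

lemmas fg_linear_simps =
  linear_0[OF f_linear] linear_add[OF f_linear] linear_cmul[OF f_linear] linear_diff[OF f_linear]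
  linear_0[OF g_linear] linear_add[OF g_linear] linear_cmul[OF g_linear] linear_diff[OF g_linear]

lemma T_linear: "linear T"
  by (auto simp: T_def linear_iff fg_linear_simps algebra_simps)

lemma N_linear: "linear N"
  by (auto simp: N_def linear_iff fg_linear_simps algebra_simps)

lemmas pT_pCons = poly_act_pCons[OF T_linear]
lemmas pT_add = poly_act_add[OF T_linear]
lemmas pT_smult = poly_act_smult[OF T_linear]
lemmas pT_minus = poly_act_minus[OF T_linear]
lemmas pT_diff = poly_act_diff[OF T_linear]
lemmas pT_mult = poly_act_mult[OF T_linear]
lemmas pT_one = poly_act_one[OF T_linear]
lemmas pT_linear = poly_act_linear[OF T_linear]

lemma N_N: "N (N x) = pT [:-4, 0, 1:] x"
proof -
  have "4 *\<^sub>R x = x + x + x + x"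
    using scaleR_left_distrib[of 2 2 x] by (simp add: scaleR_2)
  then show ?thesis
    by (simp add: N_def T_def pT_pCons poly_act_0[OF T_linear] fg_linear_simps)
qed

lemma f_pT: "f (pT p x) = pT p (f x)"
  by (rule poly_act_commute[OF T_linear f_linear]) (simp add: T_def fg_linear_simps add.commute)

lemma g_pT: "g (pT p x) = pT p (g x)"
  by (rule poly_act_commute[OF T_linear g_linear]) (simp add: T_def fg_linear_simps add.commute)

lemma N_pT: "N (pT p x) = pT p (N x)"
  by (simp add: N_def f_pT g_pT linear_diff[OF pT_linear])

lemma pT_pT_commute: "pT p (pT q x) = pT q (pT p x)"
  by (metis pT_mult mult.commute)

lemma w_T: "w (T x) y = w x (T y)"
  by (simp add: T_def w_simps w_f_left w_g_left)

lemma w_N: "w (N x) y = - w x (N y)"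
  by (simp add: N_def w_simps w_f_left w_g_left)

lemma w_pT: "w (pT p x) y = w x (pT p y)"
proof (induction p arbitrary: x y)
  case 0
  then show ?case by (simp add: poly_act_0[OF T_linear] w_simps)
next
  case (pCons a p)
  have "T (pT p y) = pT p (T y)" by (rule poly_act_commute[OF T_linear T_linear]) simp
  then show ?case by (simp add: pT_pCons w_simps w_T pCons.IH)
qed

text \<open>Self-adjointness of \<open>pT p\<close> meets skewness of \<open>w\<close>. Hence the
  polynomials in \<open>T\<close> applied to one vector span an isotropic space, and
  \<open>N\<close> or a second vector is needed to reach a nondegenerate one.\<close>

lemma w_pT_self: "w x (pT p x) = 0"
  using w_pT[of p x x] skew[of "pT p x" x] by simp

lemma invariant_T: "invariant U \<Longrightarrow> x \<in> U \<Longrightarrow> T x \<in> U"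
  by (auto simp: invariant_def T_def subspace_add)

lemma invariant_N: "invariant U \<Longrightarrow> x \<in> U \<Longrightarrow> N x \<in> U"
  by (auto simp: invariant_def N_def subspace_diff)

lemma invariant_pT: "invariant U \<Longrightarrow> x \<in> U \<Longrightarrow> pT p x \<in> U"
  using poly_act_in_subspace[OF T_linear] invariant_T by (auto simp: invariant_def)

end

section \<open>Spaces without proper nonzero nondegenerate invariant subspaces\<close>

locale minimal_symplectic_map = symplectic_map w f g
  for w :: "'a::euclidean_space \<Rightarrow> 'a \<Rightarrow> real" and f g +
  fixes U :: "'a set"
  assumes inv: "invariant U" and nondeg: "nondegenerate_on w U"
    and minimal: "invariant K \<Longrightarrow> nondegenerate_on w K \<Longrightarrow> K \<subseteq> U \<Longrightarrow> x \<in> K \<Longrightarrow> x \<noteq> 0 \<Longrightarrow> K = U"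
begin

lemma subspace_U: "subspace U"
  using inv by (simp add: invariant_def)

lemmas N_in = invariant_N[OF inv] and pT_in = invariant_pT[OF inv]

text \<open>Fitting's lemma. The kernel and the image of a self-adjoint operator are orthogonal, so the
  Fitting decomposition is an orthogonal one and must be trivial.\<close>

lemma noninjective_imp_nilpotent:
  assumes z: "z \<in> U" "z \<noteq> 0" "pT p z = 0"
  shows "\<exists>d. \<forall>u\<in>U. pT (p ^ d) u = 0"
proof -
  \<comment> \<open>The exponent starts at one so that \<open>z\<close>, killed by \<open>p\<close>,
    also lies in the kernel \<open>K\<close> and makes it nonzero.\<close>
  define I where "I d = pT (p ^ Suc d) ` U" for d
  \<comment> \<open>An image of least dimension is stable: applying \<open>q\<close> once more does
    not shrink it.\<close>
  obtain d where d: "\<And>e. dim (I d) \<le> dim (I e)"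
    using ex_has_least_nat[of "\<lambda>_. True" 0 "\<lambda>d. dim (I d)"] by auto
  define q where "q = p ^ Suc d"
  have I_double: "I (d + Suc d) = pT q ` pT q ` U"
    unfolding I_def q_def image_image pT_mult[symmetric] power_add[symmetric] by simp
  have Id: "I d = pT q ` U" by (simp add: I_def q_def)
  have "I (d + Suc d) \<subseteq> I d"
    unfolding I_double Id using pT_in by blast
  moreover have "subspace (I e)" for e
    unfolding I_def by (rule linear_subspace_image[OF pT_linear subspace_U])
  ultimately have "I (d + Suc d) = I d"
    using d by (intro subspace_dim_equal)
  then have I_eq: "pT q ` pT q ` U = pT q ` U"
    unfolding I_double Id .
  define K where "K = {u\<in>U. pT q u = 0}"
  have split: "\<exists>v\<in>U. u - pT q v \<in> K" if u: "u \<in> U" for u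
  proof -
    have "pT q u \<in> pT q ` pT q ` U" using u I_eq by blast
    then obtain v where v: "v \<in> U" "pT q u = pT q (pT q v)" by blast
    then have "pT q (u - pT q v) = 0" by (simp add: linear_diff[OF pT_linear])
    then show ?thesis using u v pT_in subspace_U
      by (intro bexI[of _ v]) (auto simp: K_def subspace_diff)
  qed
  have "K = U"
  proof (rule minimal)
    show "invariant K"
      unfolding invariant_def K_def using inv subspace_U
      by (auto simp: invariant_def subspace_def linear_0[OF pT_linear] linear_add[OF pT_linear]
          linear_cmul[OF pT_linear] f_pT[symmetric] g_pT[symmetric] fg_linear_simps)
    show "nondegenerate_on w K"
      unfolding nondegenerate_on_def
    proof (intro ballI impI)
      fix x assume x: "x \<in> K" and orth: "\<forall>y\<in>K. w x y = 0"
      have "w x u = 0" if u: "u \<in> U" for u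
      proof -
        obtain v where v: "v \<in> U" "u - pT q v \<in> K" using split u by blast
        have "w x (pT q v) = 0"
          using x by (simp add: w_pT[symmetric] K_def w_simps)
        moreover have "w x (u - pT q v) = 0" using orth v by blast
        ultimately show ?thesis by (simp add: w_simps)
      qed
      then show "x = 0" using x by (intro nondegenerate_onD[OF nondeg]) (auto simp: K_def)
    qed
    show "z \<in> K" using z by (simp add: K_def q_def power_Suc2 pT_mult linear_0[OF pT_linear] del: power_Suc)
  qed (use z in \<open>auto simp: K_def\<close>)
  then show ?thesis unfolding K_def q_def by blast
qed

text \<open>A polynomial of least degree with a kernel vector \<open>z\<close> in \<open>U\<close>
  is irreducible: in a factorization \<open>a * b\<close>, either \<open>b\<close> kills
  \<open>z\<close> or \<open>a\<close> kills the nonzero vector \<open>pT b z\<close>, and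
  minimality makes the other factor constant.\<close>

lemma exists_irreducible_noninjective:
  assumes "x \<in> U" "x \<noteq> 0"
  shows "\<exists>p. irreducible p \<and> (\<exists>z\<in>U. z \<noteq> 0 \<and> pT p z = 0)"
proof -
  define Q where "Q p \<longleftrightarrow> p \<noteq> 0 \<and> (\<exists>z\<in>U. z \<noteq> 0 \<and> pT p z = 0)" for p
  obtain q where "Q q"
    using exists_annihilating_poly[OF T_linear, of x] assms unfolding Q_def by blast
  then obtain p where p: "Q p" and least: "\<And>q. Q q \<Longrightarrow> degree p \<le> degree q"
    using ex_has_least_nat[of Q q degree] by blast
  obtain z where z: "z \<in> U" "z \<noteq> 0" "pT p z = 0" using p unfolding Q_def by blast
  have "irreducible p"
  proof (rule irreducibleI)
    show "p \<noteq> 0" using p by (simp add: Q_def)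
    show "\<not> p dvd 1"
    proof
      assume "p dvd 1"
      then obtain r where "1 = r * p" by (metis dvdE mult.commute)
      then have "z = pT r (pT p z)" by (metis pT_mult pT_one)
      then show False using z linear_0[OF pT_linear] by simp
    qed
    fix a b assume ab: "p = a * b"
    then have deg: "degree p = degree a + degree b" and nz: "a \<noteq> 0" "b \<noteq> 0"
      using \<open>p \<noteq> 0\<close> by (auto simp: degree_mult_eq)
    show "a dvd 1 \<or> b dvd 1"
    proof (cases "pT b z = 0")
      case True
      then have "Q b" using nz z by (auto simp: Q_def)
      then have "degree a = 0" using least deg by fastforce
      then show ?thesis using nz by (simp add: is_unit_iff_degree)
    next
      case False
      moreover have "pT a (pT b z) = 0" using z(3) by (simp add: ab pT_mult)
      ultimately have "Q a" using nz z pT_in by (auto simp: Q_def)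
      then have "degree b = 0" using least deg by fastforce
      then show ?thesis using nz by (simp add: is_unit_iff_degree)
    qed
  qed
  then show ?thesis using z by blast
qed

text \<open>On the kernel of \<open>N\<close> the map \<open>f\<close> is an involution, so
  \<open>z\<close> is an eigenvector for \<open>-1\<close> or \<open>f z + z\<close> is one for
  \<open>1\<close>. An eigenvalue \<open>e\<close> of \<open>f\<close> gives the eigenvalue
  \<open>2 * e\<close> of \<open>T\<close>.\<close>

lemma N_noninjective:
  assumes "z \<in> U" "z \<noteq> 0" "N z = 0"
  shows "\<exists>e\<in>{1, -1}. \<exists>z\<in>U. z \<noteq> 0 \<and> pT [:-2 * e, 1:] z = 0"
proof -
  have ff: "f (f z) = z" using assms(3) by (simp add: N_def)
  have eigen: "pT [:-2 * e, 1:] y = 0" if "f y = e *\<^sub>R y" "e \<in> {1, -1}" for e y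
  proof -
    have "g y = e *\<^sub>R e *\<^sub>R g y" using that(2) by auto
    also have "e *\<^sub>R g y = g (f y)" by (simp only: that(1) fg_linear_simps)
    finally have "g y = e *\<^sub>R y" by simp
    then show ?thesis
      using that by (auto simp: pT_pCons poly_act_0[OF T_linear] T_def fg_linear_simps scaleR_2)
  qed
  show ?thesis
  proof (cases "f z + z = 0")
    case True
    then have "f z = - z" by (simp add: eq_neg_iff_add_eq_0)
    then show ?thesis using eigen[of z "-1"] assms by auto
  next
    case False
    have "f (f z + z) = f z + z" using ff by (simp add: fg_linear_simps add.commute)
    moreover have "f z + z \<in> U" using assms inv by (auto simp: invariant_def subspace_add)
    ultimately show ?thesis using eigen[of "f z + z" 1] False by auto
  qed
qed

text \<open>Choosing a linear \<open>p\<close> as soon as \<open>N\<close> has a kernel settles the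
  shape of \<open>p\<close> in the degenerate case beforehand, without a uniqueness argument for
  \<open>p\<close>.\<close>

lemma exists_adapted_irreducible:
  assumes "x \<in> U" "x \<noteq> 0"
  shows "\<exists>p. irreducible p \<and> (\<exists>z\<in>U. z \<noteq> 0 \<and> pT p z = 0) \<and>
    ((\<exists>z\<in>U. z \<noteq> 0 \<and> N z = 0) \<longrightarrow> (\<exists>e\<in>{1, -1}. p = [:-2 * e, 1:]))"
proof (cases "\<exists>z\<in>U. z \<noteq> 0 \<and> N z = 0")
  case True
  then obtain e where e: "e \<in> {1, -1}" "\<exists>z\<in>U. z \<noteq> 0 \<and> pT [:-2 * e, 1:] z = 0"
    using N_noninjective by blast
  moreover have "irreducible [:-2 * e, 1:]"
    by (rule irreducible_linear_field_poly) simp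
  ultimately show ?thesis by blast
next
  case False
  then show ?thesis using exists_irreducible_noninjective[OF assms] by blast
qed

section \<open>Vectors generated by \<open>x\<close> and \<open>y\<close> under polynomials in
  \<open>T\<close> and \<open>N\<close>\<close>

definition comb :: "'a \<Rightarrow> 'a \<Rightarrow> real poly \<Rightarrow> real poly \<Rightarrow> real poly \<Rightarrow> real poly \<Rightarrow> 'a" where
  "comb x y a b c d = pT a x + pT b (N x) + pT c y + pT d (N y)"

abbreviation (input) half :: "real poly \<Rightarrow> real poly" where "half \<equiv> smult (1/2)"
abbreviation (input) Q :: "real poly" where "Q \<equiv> [:-4, 0, 1:]"

lemma comb_add:
  "comb x y a b c d + comb x y a' b' c' d' = comb x y (a + a') (b + b') (c + c') (d + d')"
  by (simp add: comb_def pT_add)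

lemma comb_diff:
  "comb x y a b c d - comb x y a' b' c' d' = comb x y (a - a') (b - b') (c - c') (d - d')"
  by (simp add: comb_def pT_diff)

lemma comb_scale:
  "t *\<^sub>R comb x y a b c d = comb x y (smult t a) (smult t b) (smult t c) (smult t d)"
  by (simp add: comb_def pT_smult scaleR_add_right)

lemma T_comb:
  "T (comb x y a b c d) = comb x y (pCons 0 a) (pCons 0 b) (pCons 0 c) (pCons 0 d)"
  by (simp add: comb_def pT_pCons linear_add[OF T_linear])

text \<open>Since \<open>N\<close> squared is \<open>pT Q\<close>, no power of \<open>N\<close>
  beyond the first is needed, and the vectors \<open>comb x y a b c d\<close> are closed under
  \<open>N\<close>.\<close>

lemma N_comb: "N (comb x y a b c d) = comb x y (Q * b) a (Q * d) c"
proof -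
  have "N (pT b (N x)) = pT (Q * b) x" for b x
    by (simp only: N_pT N_N pT_mult pT_pT_commute[of Q])
  then show ?thesis
    by (simp only: comb_def linear_add[OF N_linear] N_pT add_ac)
qed

lemma f_T_N: "f v = (1/2) *\<^sub>R (T v + N v)" and g_T_N: "g v = (1/2) *\<^sub>R (T v - N v)"
  by (simp_all add: T_def N_def flip: scaleR_2)

text \<open>The pairings of each of \<open>x\<close>, \<open>N x\<close>, \<open>y\<close>,
  \<open>N y\<close> with itself vanish by \<open>w_pT_self\<close>, and the hypothesis removes
  those of \<open>x\<close> with \<open>N y\<close> and of \<open>N x\<close> with \<open>y\<close>.
  Every surviving term joins one of \<open>a\<close>, \<open>d\<close> to one of \<open>b\<close>,
  \<open>c\<close>, so negating \<open>b\<close> and \<open>c\<close> reverses the form.\<close>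

lemma w_comb:
  assumes "\<And>r. w x (pT r (N y)) = 0"
  shows "w (comb x y a b c d) (comb x y a' b' c' d') =
    w x (pT (a * b' - b * a') (N x)) + w x (pT (a * c' - c * a') y)
    - w x (pT ((b * d' - d * b') * Q) y) + w y (pT (c * d' - d * c') (N y))"
proof -
  have swap: "w (pT a u) (pT b v) = w u (pT (a * b) v)" for a b u v
    by (simp add: w_pT pT_mult)
  have swap': "w y (pT r x) = - w x (pT r y)" for r
    using skew[of y "pT r x"] by (simp add: w_pT)
  have N1: "w (N u) (pT r v) = - w u (pT r (N v))" for u v r
    by (simp add: w_N N_pT)
  have N0: "w y (pT r (N x)) = 0" for r
    using assms[of r] skew[of y "pT r (N x)"] by (simp add: w_pT N1)
  show ?thesis
    unfolding comb_def
    by (simp only: w_simps swap N1 N_N pT_mult[symmetric] N0 assms w_pT_self swap' pT_diff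
        left_diff_distrib mult_ac)
qed

text \<open>The involution fixes \<open>x\<close>, negates \<open>y\<close> and anticommutes with \<open>N\<close>.\<close>

lemma reversible_on_comb:
  assumes x: "x \<in> U" "x \<noteq> 0" and y: "y \<in> U" and xy: "\<And>r. w x (pT r (N y)) = 0"
    and radical: "\<And>a b c d. (\<And>a' b' c' d'. w (comb x y a b c d) (comb x y a' b' c' d') = 0)
      \<Longrightarrow> comb x y a b c d = 0"
  shows "reversible_on U"
proof -
  define W where "W = {comb x y a b c d | a b c d. True}"
  have WI: "comb x y a b c d \<in> W" for a b c d by (auto simp: W_def)
  have WE: "\<exists>a b c d. v = comb x y a b c d" if "v \<in> W" for v using that by (auto simp: W_def)
  have W_sub: "subspace W"
  proof (rule subspaceI)
    have "comb x y 0 0 0 0 = 0" by (simp add: comb_def poly_act_0[OF T_linear])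
    then show "0 \<in> W" using WI[of 0 0 0 0] by simp
  qed (use WE WI comb_add comb_scale in metis)+
  have W_TN: "T v \<in> W" "N v \<in> W" if "v \<in> W" for v
    using WE[OF that] WI by (auto simp: T_comb N_comb simp del: mult_pCons_left)
  have W_inv: "invariant W"
    unfolding invariant_def using W_sub W_TN
    by (auto simp: f_T_N g_T_N intro!: subspace_scale subspace_add subspace_diff)
  have "comb x y 1 0 0 0 = x" by (simp add: comb_def pT_one poly_act_0[OF T_linear])
  then have xW: "x \<in> W" using WI by metis
  \<comment> \<open>The generated space contains the nonzero vector \<open>x\<close> and is
    nondegenerate by \<open>radical\<close>, so minimality applies.\<close>
  have WU: "W = U"
  proof (rule minimal[OF W_inv _ _ xW x(2)])
    show "W \<subseteq> U" using x y subspace_U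
      by (auto simp: W_def comb_def intro!: subspace_add pT_in N_in)
    show "nondegenerate_on w W" unfolding nondegenerate_on_def
      using WE WI radical by metis
  qed
  \<comment> \<open>Different coefficients may give the same vector, so this is only a relation at
    first; \<open>reversible_on_relation\<close> turns it into a map.\<close>
  define G where "G = {(comb x y a b c d, comb x y a (-b) (-c) d) | a b c d. True}"
  have GI: "(comb x y a b c d, comb x y a (-b) (-c) d) \<in> G" for a b c d by (auto simp: G_def)
  show ?thesis
  proof (rule reversible_on_relation[OF inv nondeg, of G])
    have "fst ` G = W" by (force simp: G_def W_def)
    then show "span (fst ` G) = U" using WU subspace_U by (simp add: span_eq_iff[THEN iffD2])
  next
    fix v v' u u' assume "(v, u) \<in> G" "(v', u') \<in> G"
    then obtain a b c d a' b' c' d' where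
      "v = comb x y a b c d" "u = comb x y a (-b) (-c) d"
      "v' = comb x y a' b' c' d'" "u' = comb x y a' (-b') (-c') d'"
      by (auto simp: G_def)
    then show "w u u' = - w v v'"
      by (simp add: w_comb[OF xy] pT_diff pT_add pT_minus w_simps left_diff_distrib algebra_simps
          del: mult_pCons_right)
  next
    fix v u assume "(v, u) \<in> G"
    then obtain a b c d where vu: "v = comb x y a b c d" "u = comb x y a (-b) (-c) d"
      by (auto simp: G_def)
    show "(u, v) \<in> G" using GI[of a "-b" "-c" d] vu by simp
    have "f v = comb x y (half (pCons 0 a + Q * b)) (half (pCons 0 b + a))
        (half (pCons 0 c + Q * d)) (half (pCons 0 d + c))"
      by (simp only: vu f_T_N T_comb N_comb comb_add comb_scale)
    moreover have "g u = comb x y (half (pCons 0 a + Q * b)) (- half (pCons 0 b + a))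
        (- half (pCons 0 c + Q * d)) (half (pCons 0 d + c))"
    proof -
      have "pCons 0 a - Q * (- b) = pCons 0 a + Q * b" "pCons 0 d - (- c) = pCons 0 d + c"
        "half (pCons 0 (- b) - a) = - half (pCons 0 b + a)"
        "half (pCons 0 (- c) - Q * d) = - half (pCons 0 c + Q * d)"
        by (simp_all add: smult_add_right smult_diff_right del: mult_pCons_left)
      then show ?thesis
        by (simp only: vu g_T_N T_comb N_comb comb_diff comb_scale)
    qed
    ultimately show "(f v, g u) \<in> G" using GI by metis
  qed
qed

end

section \<open>The primary case, where a power of an irreducible polynomial in \<open>T\<close>
  vanishes\<close>

locale primary_symplectic_map = minimal_symplectic_map w f g U
  for w :: "'a::euclidean_space \<Rightarrow> 'a \<Rightarrow> real" and f g U +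
  fixes p :: "real poly" and k :: nat
  assumes p_irreducible: "irreducible p"
    and p_nilpotent: "u \<in> U \<Longrightarrow> pT (p ^ Suc k) u = 0"
begin

lemma p_prime: "prime_elem p"
  using p_irreducible by (rule field_poly_irreducible_imp_prime)

lemma pT_eq_0_if_dvd: "p ^ Suc k dvd r \<Longrightarrow> u \<in> U \<Longrightarrow> pT r u = 0"
  using p_nilpotent linear_0[OF pT_linear]
  by (metis dvdE mult.commute pT_mult)

text \<open>A Bezout relation between \<open>c\<close> and \<open>p ^ Suc k\<close> yields an
  inverse of \<open>pT c\<close> on \<open>U\<close>.\<close>

lemma unit_mod_p:
  assumes "\<not> p dvd c"
  shows "\<exists>e. \<forall>u\<in>U. pT (e * c) u = u"
proof -
  have "coprime c (p ^ Suc k)"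
    using prime_elem_imp_coprime[OF p_prime assms] by (simp add: coprime_commute)
  then have "gcd c (p ^ Suc k) = 1" by (rule coprime_imp_gcd_eq_1)
  then obtain e d where ed: "e * c + d * p ^ Suc k = 1"
    by (metis bezout_coefficients_fst_snd)
  have "pT (e * c) u = u" if "u \<in> U" for u
  proof -
    have "pT (e * c + d * p ^ Suc k) u = u" by (simp only: ed pT_one)
    then show ?thesis using pT_eq_0_if_dvd[of "d * p ^ Suc k" u] that by (simp add: pT_add del: power_Suc)
  qed
  then show ?thesis by blast
qed

text \<open>Every nonzero ideal modulo \<open>p ^ Suc k\<close> contains \<open>p ^ k\<close>: write
  \<open>b\<close> as a power of \<open>p\<close> with exponent at most \<open>k\<close> times a
  factor prime to \<open>p\<close>, invert that factor and supply the missing powers.\<close>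

lemma divides_socle:
  assumes "\<not> p ^ Suc k dvd b"
  shows "\<exists>c. \<forall>u\<in>U. pT (c * b) u = pT (p ^ k) u"
proof -
  have "b \<noteq> 0" using assms by auto
  moreover have "\<not> p dvd 1" using p_prime by (simp add: prime_elem_def)
  ultimately obtain c where c: "b = p ^ multiplicity p b * c" "\<not> p dvd c"
    by (rule multiplicity_decompose')
  define j where "j = multiplicity p b"
  have j: "j \<le> k"
  proof (rule ccontr)
    assume "\<not> j \<le> k"
    then have "p ^ Suc k dvd p ^ j" by (intro le_imp_power_dvd) simp
    then show False using assms c(1) j_def by (metis dvd_mult2)
  qed
  obtain e where e: "\<And>u. u \<in> U \<Longrightarrow> pT (e * c) u = u" using unit_mod_p[OF c(2)] by blast
  have "(e * p ^ (k - j)) * b = p ^ k * (e * c)"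
  proof -
    have "p ^ k = p ^ (k - j) * p ^ j" using j by (simp flip: power_add)
    then show ?thesis using c(1) j_def by (simp add: mult_ac)
  qed
  then show ?thesis using e by (metis pT_mult)
qed

text \<open>Here \<open>x\<close> alone generates, so the second generator is \<open>0\<close>. A
  coefficient of a radical vector that is not divisible by \<open>p ^ Suc k\<close> could be
  multiplied up to \<open>p ^ k\<close>, contradicting the assumption on \<open>x\<close>.\<close>

lemma reversible_cyclic:
  assumes x: "x \<in> U" "w x (pT (p ^ k) (N x)) \<noteq> 0"
  shows "reversible_on U"
proof (rule reversible_on_comb[of x 0])
  show "x \<noteq> 0" using x(2) by (auto simp: w_simps)
  have N0: "N 0 = 0" by (rule linear_0[OF N_linear])
  show xy: "w x (pT r (N 0)) = 0" for r by (simp add: N0 linear_0[OF pT_linear] w_simps)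
  have zero: "pT a u = 0" if a: "\<And>r. w x (pT (a * r) (N x)) = 0" and u: "u \<in> U" for a u
  proof (rule pT_eq_0_if_dvd[OF _ u], rule ccontr)
    assume "\<not> p ^ Suc k dvd a"
    then obtain c where "\<forall>u\<in>U. pT (c * a) u = pT (p ^ k) u" using divides_socle by blast
    then have "pT (a * c) (N x) = pT (p ^ k) (N x)" using N_in[OF x(1)] by (simp add: mult.commute)
    then show False using a[of c] x(2) by simp
  qed
  fix a b c d
  assume "\<And>a' b' c' d'. w (comb x 0 a b c d) (comb x 0 a' b' c' d') = 0"
  then have *: "w x (pT (a * b' - b * a') (N x)) = 0" for a' b'
    unfolding w_comb[OF xy] by (simp add: N0 linear_0[OF pT_linear] w_simps)
  have "pT a x = 0" using *[of _ 0] x by (intro zero) simp_all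
  moreover have "pT b (N x) = 0" using *[of 0] x N_in
    by (intro zero) (simp_all add: pT_minus w_simps)
  ultimately show "comb x 0 a b c d = 0" by (simp add: comb_def N0 linear_0[OF pT_linear])
qed (use x subspace_U in \<open>auto simp: subspace_0\<close>)

text \<open>Polarization: as \<open>N\<close> is anti-self-adjoint and \<open>w\<close> skew,
  \<open>w u (pT (p ^ k) (N v))\<close> is symmetric in \<open>u\<close> and \<open>v\<close>, so it
  vanishes with its diagonal.\<close>

lemma socle_N_zero:
  assumes iso: "\<And>x. x \<in> U \<Longrightarrow> w x (pT (p ^ k) (N x)) = 0" and u: "u \<in> U"
  shows "pT (p ^ k) (N u) = 0"
proof (rule nondegenerate_onD[OF nondeg])
  let ?s = "pT (p ^ k)"
  show "?s (N u) \<in> U" using u by (intro pT_in N_in)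
  fix v assume v: "v \<in> U"
  have "w (u + v) (?s (N (u + v))) = 0" using u v subspace_U by (intro iso) (rule subspace_add)
  then have "w u (?s (N v)) + w v (?s (N u)) = 0"
    using iso[OF u] iso[OF v]
    by (simp add: linear_add[OF N_linear] linear_add[OF pT_linear] w_simps)
  moreover have "w u (?s (N v)) = w v (?s (N u))"
    using skew[of u "?s (N v)"] by (simp add: w_pT w_N N_pT)
  ultimately show "w (?s (N u)) v = 0" using skew[of "?s (N u)" v] by simp
qed

section \<open>The degenerate case, where \<open>p\<close> is linear with root \<open>2 * e\<close>
  and \<open>p ^ k\<close> kills the image of \<open>N\<close>\<close>

context
  fixes e :: real
  assumes e: "e \<in> {1, -1}" and p_def: "p = [:-2 * e, 1:]"
    and sN: "u \<in> U \<Longrightarrow> pT (p ^ k) (N u) = 0"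
begin

lemma Q_factor: "[:-4, 0, 1:] = p * [:2 * e, 1:]"
  using e by (auto simp: p_def)

text \<open>The second factor of \<open>X^2 - 4\<close> has the nonzero value \<open>4 * e\<close>
  at the root of \<open>p\<close>; thus \<open>X^2 - 4\<close> contains \<open>p\<close> exactly
  once.\<close>

lemma pow_dvd_cofactor: "p ^ j dvd r * [:2 * e, 1:] \<longleftrightarrow> p ^ j dvd r"
proof (rule coprime_dvd_mult_left_iff)
  have "\<not> p dvd [:2 * e, 1:]"
  proof
    assume "p dvd [:2 * e, 1:]"
    then have "poly [:2 * e, 1:] (2 * e) = 0"
      using poly_eq_0_iff_dvd[of "[:2 * e, 1:]" "2 * e"] by (simp add: p_def)
    then show False using e by auto
  qed
  then show "coprime (p ^ j) [:2 * e, 1:]"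
    using prime_elem_imp_coprime[OF p_prime] by simp
qed

lemma pT_N_eq_0_if_dvd: "p ^ k dvd r \<Longrightarrow> u \<in> U \<Longrightarrow> pT r (N u) = 0"
  using sN linear_0[OF pT_linear]
  by (metis dvdE mult.commute pT_mult)

text \<open>Such a \<open>y\<close> exists once \<open>pT (p ^ k) x\<close> lies outside the space
  \<open>D\<close> of all \<open>pT r (N x)\<close>. If it equalled \<open>pT r (N x)\<close>,
  applying \<open>N\<close> would give \<open>pT (r * Q) x = 0\<close>; then
  \<open>p ^ Suc k\<close> divides \<open>r * Q\<close>, so \<open>p ^ k\<close> divides
  \<open>r\<close>, and \<open>pT r (N x)\<close> would vanish.\<close>

lemma exists_dual_vector:
  assumes x: "x \<in> U" "pT (p ^ k) x \<noteq> 0"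
  shows "\<exists>y\<in>U. w x (pT (p ^ k) y) \<noteq> 0 \<and> (\<forall>r. w x (pT r (N y)) = 0)"
proof -
  define D where "D = range (\<lambda>r. pT r (N x))"
  have D: "subspace D"
    unfolding D_def
  proof (rule subspaceI)
    show "0 \<in> range (\<lambda>r. pT r (N x))"
      by (rule range_eqI[of _ _ 0]) (simp add: poly_act_0[OF T_linear])
  qed (auto simp flip: pT_add pT_smult)
  have notin: "pT (p ^ k) x \<notin> D"
  proof
    assume "pT (p ^ k) x \<in> D"
    then obtain r where r: "pT (p ^ k) x = pT r (N x)" by (auto simp: D_def)
    have "pT (r * [:-4, 0, 1:]) x = N (pT r (N x))" by (simp only: N_pT N_N pT_mult)
    also have "\<dots> = 0" by (simp only: r[symmetric] N_pT sN[OF x(1)])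
    finally have zero: "pT (r * [:-4, 0, 1:]) x = 0" .
    have "p ^ Suc k dvd r * [:-4, 0, 1:]"
    proof (rule ccontr)
      assume "\<not> ?thesis"
      then obtain c where "\<forall>u\<in>U. pT (c * (r * [:-4, 0, 1:])) u = pT (p ^ k) u"
        using divides_socle by blast
      then show False using x zero linear_0[OF pT_linear] by (metis pT_mult)
    qed
    then have "p * p ^ k dvd p * (r * [:2 * e, 1:])"
      unfolding Q_factor by (simp only: power_Suc mult_ac)
    then have "p ^ k dvd r"
      using p_irreducible pow_dvd_cofactor by (metis dvd_mult_cancel_left irreducible_def)
    then show False using pT_N_eq_0_if_dvd[OF _ x(1)] r x(2) by simp
  qed
  \<comment> \<open>The Euclidean component \<open>z\<close> orthogonal to \<open>D\<close> supplies
    a functional that vanishes on \<open>D\<close> but not at \<open>pT (p ^ k) x\<close>; Riesz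
    representation turns it into \<open>y\<close>.\<close>
  obtain a z where az: "a \<in> span D" "\<And>v. v \<in> span D \<Longrightarrow> orthogonal z v" "pT (p ^ k) x = a + z"
    using orthogonal_subspace_decomp_exists[of D "pT (p ^ k) x"] by blast
  have "z \<noteq> 0" using az notin D by (auto simp: span_eq_iff[THEN iffD2])
  then have zx: "z \<bullet> pT (p ^ k) x \<noteq> 0"
    using az(2)[OF az(1)] by (simp add: az(3) inner_add_right orthogonal_def)
  obtain y where y: "y \<in> U" "\<And>v. v \<in> U \<Longrightarrow> w v y = z \<bullet> v"
    using riesz_on[OF subspace_U nondeg, of "(\<bullet>) z"]
    by (auto simp: linear_iff inner_add_right)
  have "w x (pT (p ^ k) y) \<noteq> 0"
    using y(2)[of "pT (p ^ k) x"] x pT_in zx by (simp add: w_pT)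
  moreover have "w x (pT r (N y)) = 0" for r
  proof -
    have "w x (pT r (N y)) = - w (pT r (N x)) y" by (simp add: w_pT w_N N_pT)
    also have "\<dots> = - (z \<bullet> pT r (N x))" using y(2) x pT_in N_in by simp
    also have "\<dots> = 0" using az(2)[of "pT r (N x)"]
      by (simp add: D_def orthogonal_def span_base)
    finally show ?thesis .
  qed
  ultimately show ?thesis using y(1) by blast
qed

text \<open>If \<open>C\<close> were \<open>p ^ j\<close> times a factor prime to \<open>p\<close>,
  a suitable multiplier \<open>r\<close> would make \<open>C * r\<close> act on \<open>y\<close> as
  \<open>p ^ k\<close>, giving a nonzero left side. The same \<open>r\<close> makes
  \<open>B * r\<close> divisible by \<open>p ^ k\<close>, which kills \<open>N u\<close>.\<close>

lemma pow_dvd_step: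
  assumes y: "y \<in> U" "w x (pT (p ^ k) y) \<noteq> 0" and u: "u \<in> U"
    and j: "j \<le> k" "p ^ j dvd B" "p ^ j dvd C"
    and eq: "\<And>r. w x (pT (C * r) y) = t * w u (pT (B * r) (N u))"
  shows "p ^ Suc j dvd C"
proof -
  obtain B' C' where BC: "B = p ^ j * B'" "C = p ^ j * C'" using j by (auto elim!: dvdE)
  have pk: "p ^ k = p ^ j * p ^ (k - j)" using j by (simp flip: power_add)
  have "p dvd C'"
  proof (rule ccontr)
    assume "\<not> p dvd C'"
    then obtain e' where e': "\<And>u. u \<in> U \<Longrightarrow> pT (e' * C') u = u" using unit_mod_p by blast
    have "C * (p ^ (k - j) * e') = p ^ k * (e' * C')" by (simp add: BC pk mult_ac)
    then have "pT (C * (p ^ (k - j) * e')) y = pT (p ^ k) y"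
      using e'[OF y(1)] by (metis pT_mult)
    moreover have "p ^ k dvd B * (p ^ (k - j) * e')"
      unfolding BC pk by (rule dvdI[of _ _ "B' * e'"]) (simp add: mult_ac)
    then have "pT (B * (p ^ (k - j) * e')) (N u) = 0" using pT_N_eq_0_if_dvd u by blast
    ultimately show False using eq[of "p ^ (k - j) * e'"] y(2) by (simp add: w_simps)
  qed
  then show ?thesis unfolding BC by (simp add: mult_dvd_mono mult.commute[of p])
qed

text \<open>The radical of the space generated by \<open>x\<close> and \<open>y\<close> is trivial:
  testing a radical vector against one coefficient at a time gives four equations, from which
  divisibility of \<open>a\<close>, \<open>b\<close>, \<open>c\<close>, \<open>d\<close> by powers
  of \<open>p\<close> is raised step by step.\<close>

lemma reversible_dual_pair:
  assumes x: "x \<in> U" "pT (p ^ k) x \<noteq> 0"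
  shows "reversible_on U"
proof -
  obtain y where y: "y \<in> U" "w x (pT (p ^ k) y) \<noteq> 0" and xy: "\<And>r. w x (pT r (N y)) = 0"
    using exists_dual_vector[OF x] by blast
  show ?thesis
  proof (rule reversible_on_comb[of x y])
    show "x \<noteq> 0" using x(2) linear_0[OF pT_linear] by auto
    fix a b c d
    assume "\<And>a' b' c' d'. w (comb x y a b c d) (comb x y a' b' c' d') = 0"
    then have *: "w x (pT (a * b' - b * a') (N x)) + w x (pT (a * c' - c * a') y)
      - w x (pT ((b * d' - d * b') * [:-4, 0, 1:]) y) + w y (pT (c * d' - d * c') (N y)) = 0"
      for a' b' c' d' by (simp only: w_comb[OF xy])
    note simps = mult_zero_right mult_zero_left diff_0 diff_0_right pT_minus w_simps
      poly_act_0[OF T_linear] minus_mult_left[symmetric]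
    have eq_c: "w x (pT (c * r) y) = -1 * w x (pT (b * r) (N x))" for r
      using *[of 0 r 0 0] by (simp add: simps del: mult_pCons_right)
    have eq_a: "w x (pT (a * r) y) = 1 * w y (pT (d * r) (N y))" for r
      using *[of 0 0 r 0] by (simp add: simps del: mult_pCons_right)
    have eq_d: "w x (pT (d * [:-4, 0, 1:] * r) y) = -1 * w x (pT (a * r) (N x))" for r
      using *[of r 0 0 0] by (simp add: simps mult_ac del: mult_pCons_right mult_pCons_left)
    have eq_b: "w x (pT (b * [:-4, 0, 1:] * r) y) = 1 * w y (pT (c * r) (N y))" for r
      using *[of 0 0 0 r] by (simp add: simps mult_ac del: mult_pCons_right mult_pCons_left)
    have cofactor: "p ^ Suc j dvd q" if "p ^ Suc (Suc j) dvd q * [:-4, 0, 1:]" for q j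
    proof -
      have "p * p ^ Suc j dvd p * (q * [:2 * e, 1:])"
        using that unfolding Q_factor by (simp only: power_Suc mult_ac)
      then have "p ^ Suc j dvd q * [:2 * e, 1:]"
        using p_irreducible by (metis dvd_mult_cancel_left irreducible_def)
      then show ?thesis by (simp only: pow_dvd_cofactor)
    qed
    \<comment> \<open>Each round first gains a power for \<open>c\<close> and \<open>a\<close>, then
      for \<open>d * Q\<close> and \<open>b * Q\<close>. \<open>Q\<close> already contributes one
      \<open>p\<close>, and \<open>cofactor\<close> removes it again.\<close>
    have "p ^ j dvd a \<and> p ^ j dvd b \<and> p ^ j dvd c \<and> p ^ j dvd d" if "j \<le> k" for j
      using that
    proof (induction j)
      case 0
      then show ?case by simp
    next
      case (Suc j)
      then have IH: "p ^ j dvd a" "p ^ j dvd b" "p ^ j dvd c" "p ^ j dvd d" and j: "j \<le> k" by auto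
      have c: "p ^ Suc j dvd c" by (rule pow_dvd_step[OF y x(1) j IH(2,3) eq_c])
      have a: "p ^ Suc j dvd a" by (rule pow_dvd_step[OF y y(1) j IH(4,1) eq_a])
      have Q_dvd: "p ^ Suc j dvd q * [:-4, 0, 1:]" if "p ^ j dvd q" for q
        unfolding Q_factor power_Suc2 by (rule mult_dvd_mono[OF that dvd_triv_left])
      have "p ^ Suc j dvd d"
        by (rule cofactor, rule pow_dvd_step[OF y x(1) Suc.prems a Q_dvd[OF IH(4)] eq_d])
      moreover have "p ^ Suc j dvd b"
        by (rule cofactor, rule pow_dvd_step[OF y y(1) Suc.prems c Q_dvd[OF IH(2)] eq_b])
      ultimately show ?case using a c by blast
    qed
    from this[of k] have k: "p ^ k dvd a" "p ^ k dvd b" "p ^ k dvd c" "p ^ k dvd d" by auto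
    \<comment> \<open>Only \<open>c\<close> and \<open>a\<close> need the last power:
      \<open>b\<close> and \<open>d\<close> act on \<open>N x\<close> and \<open>N y\<close>, where
      \<open>p ^ k\<close> suffices.\<close>
    have "p ^ Suc k dvd c" by (rule pow_dvd_step[OF y x(1) order_refl k(2,3) eq_c])
    moreover have "p ^ Suc k dvd a" by (rule pow_dvd_step[OF y y(1) order_refl k(4,1) eq_a])
    ultimately show "comb x y a b c d = 0"
      using k x(1) y(1) by (simp add: comb_def pT_N_eq_0_if_dvd pT_eq_0_if_dvd del: power_Suc)
  qed (fact x(1) y(1) xy)+
qed

end

end

section \<open>Reversibility on minimal spaces and, by induction on dimension, in general\<close>

lemma (in minimal_symplectic_map) reversible_if_minimal:
  assumes x: "x \<in> U" "x \<noteq> 0"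
  shows "reversible_on U"
proof -
  obtain p z where p: "irreducible p" and z: "z \<in> U" "z \<noteq> 0" "pT p z = 0"
    and pN: "(\<exists>z\<in>U. z \<noteq> 0 \<and> N z = 0) \<longrightarrow> (\<exists>e\<in>{1, -1}. p = [:-2 * e, 1:])"
    using exists_adapted_irreducible[OF x] by blast
  define P where "P d \<longleftrightarrow> (\<forall>u\<in>U. pT (p ^ d) u = 0)" for d
  have "\<exists>d. P d" unfolding P_def by (rule noninjective_imp_nilpotent[OF z])
  moreover have "\<not> P 0" using x by (auto simp: P_def pT_one)
  \<comment> \<open>\<open>Suc k\<close> is the least exponent killing \<open>U\<close>; it is
    positive because \<open>U\<close> is nonzero.\<close>
  ultimately obtain k where k: "P (Suc k)" "\<not> P k"
    by (metis (no_types) not0_implies_Suc LeastI not_less_Least lessI)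
  interpret primary_symplectic_map w f g U p k
    using p k(1) by unfold_locales (auto simp: P_def)
  show ?thesis
  proof (cases "\<exists>x\<in>U. w x (pT (p ^ k) (N x)) \<noteq> 0")
    case True
    then show ?thesis using reversible_cyclic by blast
  next
    case False
    then have sN: "pT (p ^ k) (N u) = 0" if "u \<in> U" for u using socle_N_zero that by blast
    obtain v where v: "v \<in> U" "pT (p ^ k) v \<noteq> 0" using k(2) by (auto simp: P_def)
    \<comment> \<open>A nonzero kernel vector of \<open>N\<close>, so the choice of \<open>p\<close>
      makes it linear.\<close>
    then have "N (pT (p ^ k) v) = 0" by (simp only: N_pT sN)
    then obtain e where "e \<in> {1, -1}" "p = [:-2 * e, 1:]" using pN v pT_in by blast
    then show ?thesis using reversible_dual_pair[OF _ _ sN v] by blast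
  qed
qed

text \<open>A proper nonzero nondegenerate invariant subspace and its complement both have smaller
  dimension; if there is none, \<open>U\<close> is minimal or zero.\<close>

theorem (in symplectic_map) nondegenerate_imp_reversible:
  assumes "invariant U" "nondegenerate_on w U"
  shows "reversible_on U"
  using assms
proof (induction "dim U" arbitrary: U rule: less_induct)
  case less
  have smaller: "dim V < dim U" if "invariant V" "V \<subseteq> U" "V \<noteq> U" for V
    using that less.prems(1) subspace_dim_equal[of V U] dim_subset[of V U]
    by (auto simp: invariant_def not_le[symmetric])
  show ?case
  proof (cases "\<exists>K x. invariant K \<and> nondegenerate_on w K \<and> K \<subseteq> U \<and> x \<in> K \<and> x \<noteq> 0 \<and> K \<noteq> U")
    case True
    then obtain K x where K: "invariant K" "nondegenerate_on w K" "K \<subseteq> U" "K \<noteq> U"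
      and x: "x \<in> K" "x \<noteq> 0" by blast
    show ?thesis
    proof (rule reversible_on_orthogonal_split[OF less.prems K(1-3)])
      show "reversible_on K" using less.hyps K smaller by blast
      fix L assume L: "invariant L" "nondegenerate_on w L" "L \<subseteq> U" "K \<inter> L = {0}"
      then have "L \<noteq> U" using x K(3) by blast
      then show "reversible_on L" using less.hyps L smaller by blast
    qed
  next
    case False
    show ?thesis
    proof (cases "\<exists>x\<in>U. x \<noteq> 0")
      case True
      interpret minimal_symplectic_map w f g U
        using less.prems False by unfold_locales blast+
      show ?thesis using True reversible_if_minimal by blast
    next
      case False
      then have "U \<subseteq> {0}" by blast
      then show ?thesis
        unfolding reversible_on_def
        by (intro exI[of _ "\<lambda>x. x"]) (auto simp: linear_iff fg_linear_simps w_simps)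
    qed
  qed
qed

section \<open>Darboux bases adapted to an antisymplectic involution\<close>

lemma (in alternating_form) w_sum_left: "w (\<Sum>i\<in>A. F i) y = (\<Sum>i\<in>A. w (F i) y)"
  by (induction A rule: infinite_finite_induct) (simp_all add: w_simps)

lemma (in alternating_form) w_sum_right: "w y (\<Sum>i\<in>A. F i) = (\<Sum>i\<in>A. w y (F i))"
  by (induction A rule: infinite_finite_induct) (simp_all add: w_simps)

text \<open>Both eigenspaces of \<open>S\<close> are isotropic, since \<open>S\<close> preserves and
  reverses the form on them. \<open>B\<close> is a basis of the \<open>+1\<close>-eigenspace; a dual
  vector \<open>y\<close> from Riesz representation is replaced by half of \<open>y - S y\<close>,
  which lies in the \<open>-1\<close>-eigenspace and pairs with \<open>B\<close> in the same
  way.\<close>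

lemma (in alternating_form) darboux_basis_of_antisymplectic_involution:
  assumes nd: "nondegenerate_on w UNIV" and S: "linear S" "\<And>x. S (S x) = x"
    and anti: "\<And>x y. w (S x) (S y) = - w x y"
  shows "\<exists>B h. finite B \<and> 2 * card B = DIM('a) \<and>
    (\<forall>b\<in>B. S b = b \<and> S (h b) = - h b) \<and>
    (\<forall>b\<in>B. \<forall>c\<in>B. w b c = 0 \<and> w (h b) (h c) = 0 \<and> w b (h c) = (if b = c then 1 else 0))"
proof -
  note lin = linear_0[OF S(1)] linear_add[OF S(1)] linear_cmul[OF S(1)] linear_diff[OF S(1)]
  define L where "L = {x. S x = x}"
  obtain B where B: "B \<subseteq> L" "independent B" "L \<subseteq> span B" and fin: "finite B"
    by (metis basis_exists finiteI_independent)
  have SB: "S b = b" if "b \<in> B" for b using B that by (auto simp: L_def)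
  have "\<exists>h. S h = - h \<and> (\<forall>b\<in>B. w b h = (if b = c then 1 else 0))" for c
  proof -
    obtain l :: "'a \<Rightarrow> real" where l: "linear l" "\<And>b. b \<in> B \<Longrightarrow> l b = (if b = c then 1 else 0)"
      using linear_independent_extend[OF B(2), of "\<lambda>b. if b = c then 1 else 0"] by blast
    obtain y where y: "\<And>z. w z y = l z" using riesz_on[OF _ nd l(1)] by auto
    have "w b (S y) = - w b y" if "b \<in> B" for b
      using anti[of b y] SB[OF that] by simp
    then show ?thesis using y l(2)
      by (intro exI[of _ "(1/2) *\<^sub>R (y - S y)"]) (auto simp: lin S(2) w_simps algebra_simps)
  qed
  then obtain h where h: "\<And>c. S (h c) = - h c"
    and dual: "\<And>b c. b \<in> B \<Longrightarrow> w b (h c) = (if b = c then 1 else 0)" by metis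
  have iso: "w x y = 0" if "S x = t *\<^sub>R x" "S y = t *\<^sub>R y" "t \<in> {1, -1}" for x y t
    using anti[of x y] that by (auto simp: w_simps)
  have BB: "w b c = 0" if "b \<in> B" "c \<in> B" for b c using iso[of b 1 c] SB that by simp
  have hh: "w (h b) (h c) = 0" for b c using iso[of "h b" "-1" "h c"] h by simp
  have dual': "w (h c) b = (if b = c then -1 else 0)" if "b \<in> B" for b c
    using dual[OF that, of c] skew[of "h c" b] by simp
  have injh: "inj_on h B"
  proof (rule inj_onI)
    fix b c assume "b \<in> B" "c \<in> B" "h b = h c"
    then show "b = c" using dual[of b b] dual[of b c] by (simp split: if_splits)
  qed
  have disj: "B \<inter> h ` B = {}"
  proof -
    have "b \<noteq> h c" if "b \<in> B" for b c
      using dual[OF that, of b] hh[of c b] by auto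
    then show ?thesis by auto
  qed
  have "independent (B \<union> h ` B)"
  proof (rule independent_if_scalars_zero)
    show "finite (B \<union> h ` B)" using fin by simp
    fix u v assume sum0: "(\<Sum>x\<in>B \<union> h ` B. u x *\<^sub>R x) = 0" and v: "v \<in> B \<union> h ` B"
    have "(\<Sum>b\<in>B. u b *\<^sub>R b) + (\<Sum>b\<in>B. u (h b) *\<^sub>R h b) = 0"
      using sum0 disj fin injh by (simp add: sum.union_disjoint sum.reindex)
    then have *: "w y ((\<Sum>b\<in>B. u b *\<^sub>R b) + (\<Sum>b\<in>B. u (h b) *\<^sub>R h b)) = 0" for y
      by (simp add: w_simps)
    have "u (h c) = 0" if "c \<in> B" for c
      using *[of c] that fin
      by (simp add: w_simps w_sum_right BB dual if_distrib sum.delta cong: if_cong)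
    moreover have "u c = 0" if "c \<in> B" for c
      using *[of "h c"] that fin
      by (simp add: w_simps w_sum_right hh dual' if_distrib sum.delta cong: if_cong)
    ultimately show "u v = 0" using v by auto
  qed
  moreover have "v \<in> span (B \<union> h ` B)" for v
  proof -
    define p where "p = (1/2) *\<^sub>R (v + S v)"
    define m where "m = (1/2) *\<^sub>R (v - S v)"
    have "S p = p" "S m = - m" by (simp_all add: p_def m_def lin S(2) algebra_simps)
    \<comment> \<open>Subtracting the expansion in the dual vectors leaves \<open>q\<close>
      orthogonal to both eigenspaces, hence zero; so \<open>h\<close> maps \<open>B\<close> onto a
      spanning set of the \<open>-1\<close>-eigenspace.\<close>
    define q where "q = m - (\<Sum>b\<in>B. w b m *\<^sub>R h b)"
    have Sq: "S q = - q"
      by (simp add: q_def lin linear_sum[OF S(1)] \<open>S m = - m\<close> h sum_negf)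
    have "q = 0"
    proof (rule nondegenerate_onD[OF nd])
      fix y
      have "w b q = 0" if "b \<in> B" for b
        using that fin
        by (simp add: q_def w_simps w_sum_right dual if_distrib sum.delta cong: if_cong)
      then have L0: "w z q = 0" if "S z = z" for z
        using w_zero_span[of z B q] B(3) that by (auto simp: L_def)
      have "w ((1/2) *\<^sub>R (y + S y)) q = 0" by (intro L0) (simp add: lin S(2) algebra_simps)
      moreover have "w ((1/2) *\<^sub>R (y - S y)) q = 0"
        using Sq by (intro iso[of _ "-1"]) (simp_all add: lin S(2) algebra_simps)
      ultimately have "w y q = 0" by (simp add: w_simps)
      then show "w q y = 0" using skew[of q y] by simp
    qed simp
    then have "m = (\<Sum>b\<in>B. w b m *\<^sub>R h b)" by (simp add: q_def)
    then have "m \<in> span (B \<union> h ` B)"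
      by (rule ssubst) (intro span_sum span_scale span_base, blast)
    moreover have "p \<in> span (B \<union> h ` B)"
      using \<open>S p = p\<close> B(3) span_mono[of B "B \<union> h ` B"] by (auto simp: L_def)
    moreover have "v = p + m" by (simp add: p_def m_def flip: scaleR_add_right scaleR_2)
    ultimately show ?thesis by (simp add: span_add)
  qed
  ultimately have "card (B \<union> h ` B) = dim (UNIV :: 'a set)"
    by (intro basis_card_eq_dim) auto
  then have "2 * card B = DIM('a)"
    using disj fin injh by (simp add: card_Un_disjoint card_image)
  then show ?thesis using fin SB h BB hh dual by (intro exI[of _ B] exI[of _ h]) auto
qed

section \<open>The standard form, its matrices and the conjugation into \<open>SpR\<close>\<close>

lemma alternating_form_omega: "alternating_form omega"
proof
  show "bilinear omega"
    by (auto simp: bilinear_def linear_iff omega_def algebra_simps sum.distrib sum_distrib_left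
        sum_subtractf)
  show "omega x y = - omega y x" for x y
    by (simp add: omega_def algebra_simps flip: sum_negf)
qed

interpretation omega: alternating_form omega by (rule alternating_form_omega)

lemma omega_axis_right: "omega x (axis (Inr i) 1) = x $ Inl i" "omega x (axis (Inl i) 1) = - x $ Inr i"
  by (simp_all add: omega_def axis_def sum_subtractf sum_negf if_distrib[of "\<lambda>a. _ * a"] sum.delta cong: if_cong)

lemma omega_nondegenerate: "nondegenerate_on omega UNIV"
  unfolding nondegenerate_on_def
proof (intro ballI impI)
  fix x :: "real ^ ('n::finite + 'n)" assume "\<forall>y\<in>UNIV. omega x y = 0"
  then have "x $ Inl i = 0" "x $ Inr i = 0" for i
    using omega_axis_right[of x i] by auto
  then show "x = 0" by (metis sum.exhaust vec_eq_iff zero_index)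
qed

lemma sum_UNIV_Plus:
  fixes F :: "'m::finite + 'n::finite \<Rightarrow> 'b::comm_monoid_add"
  shows "(\<Sum>a\<in>UNIV. F a) = (\<Sum>i\<in>UNIV. F (Inl i)) + (\<Sum>i\<in>UNIV. F (Inr i))"
  using sum.Plus[of "UNIV :: 'm set" "UNIV :: 'n set" F] by (simp add: comp_def)

lemma Rmat_mult_nth: "(Rmat *v x) $ Inl i = x $ Inl i" "(Rmat *v x) $ Inr i = - x $ Inr i"
  by (simp_all add: Rmat_def matrix_vector_mult_def if_distrib[of "\<lambda>a. a * _"] sum.delta cong: if_cong)

text \<open>The columns of \<open>C\<close> are the adapted Darboux basis: \<open>B\<close> at the
  \<open>Inl\<close> indices, where \<open>Rmat\<close> is \<open>1\<close>, and the dual vectors at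
  the \<open>Inr\<close> indices, where it is \<open>-1\<close>.\<close>

lemma antisymplectic_involution_conj_Rmat:
  fixes S :: "real ^ ('n::finite + 'n) \<Rightarrow> real ^ ('n + 'n)"
  assumes S: "linear S" "\<And>x. S (S x) = x" "\<And>x y. omega (S x) (S y) = - omega x y"
  shows "\<exists>C \<in> Sp. \<forall>x. C *v (Rmat *v x) = S (C *v x)"
proof -
  note lin = linear_add[OF S(1)] linear_cmul[OF S(1)] linear_sum[OF S(1)]
  obtain B h where fin: "finite B" and card: "2 * card B = DIM(real ^ ('n + 'n))"
    and eig: "\<And>b. b \<in> B \<Longrightarrow> S b = b" "\<And>b. b \<in> B \<Longrightarrow> S (h b) = - h b"
    and w: "\<And>b c. b \<in> B \<Longrightarrow> c \<in> B \<Longrightarrow> omega b c = 0"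
      "\<And>b c. b \<in> B \<Longrightarrow> c \<in> B \<Longrightarrow> omega (h b) (h c) = 0"
      "\<And>b c. b \<in> B \<Longrightarrow> c \<in> B \<Longrightarrow> omega b (h c) = (if b = c then 1 else 0)"
    using omega.darboux_basis_of_antisymplectic_involution[OF omega_nondegenerate S] by blast
  have "card B = CARD('n)" using card by simp
  then obtain \<beta> :: "'n \<Rightarrow> _" where \<beta>: "bij_betw \<beta> UNIV B"
    using fin by (metis finite_same_card_bij finite_class.finite_UNIV)
  then have \<beta>B: "\<beta> i \<in> B" and \<beta>eq: "\<beta> i = \<beta> j \<longleftrightarrow> i = j" for i j
    by (auto simp: bij_betw_def inj_on_eq_iff)
  have w': "omega (h (\<beta> i)) (\<beta> j) = (if i = j then -1 else 0)" for i j
    using w(3)[OF \<beta>B \<beta>B, of j i] omega.skew[of "h (\<beta> i)" "\<beta> j"] by (simp add: \<beta>eq)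
  define C :: "real ^ ('n + 'n) ^ ('n + 'n)" where
    "C = (\<chi> a b. (case b of Inl i \<Rightarrow> \<beta> i | Inr i \<Rightarrow> h (\<beta> i)) $ a)"
  have C: "C *v x = (\<Sum>i\<in>UNIV. x $ Inl i *\<^sub>R \<beta> i) + (\<Sum>i\<in>UNIV. x $ Inr i *\<^sub>R h (\<beta> i))" for x
    by (simp add: C_def vec_eq_iff matrix_vector_mult_def sum_UNIV_Plus sum_component mult.commute)
  have "omega (C *v x) (C *v y) = omega x y" for x y
    by (simp add: C omega.w_simps omega.w_sum_left omega.w_sum_right w \<beta>B \<beta>eq w' if_distrib
        sum.delta sum_subtractf omega_def[of x] cong: if_cong) (simp add: sum_negf mult.commute)
  moreover have "C *v (Rmat *v x) = S (C *v x)" for x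
    by (simp add: C Rmat_mult_nth lin eig \<beta>B sum_negf)
  ultimately show ?thesis by (auto simp: Sp_def)
qed

lemma matrix_inv_eqI:
  fixes A B :: "real ^ 'n ^ 'n"
  assumes "B ** A = mat 1"
  shows "matrix_inv A = B"
proof -
  have "A ** matrix_inv A = mat 1 \<and> matrix_inv A ** A = mat 1"
    unfolding matrix_inv_def
    by (rule someI[of _ B]) (use assms in \<open>simp add: matrix_left_right_inverse\<close>)
  then have "B ** (A ** matrix_inv A) = B" by simp
  then show ?thesis by (simp add: matrix_mul_assoc assms)
qed

text \<open>Preserving a nondegenerate form makes \<open>A\<close> injective, hence
  invertible.\<close>

lemma Sp_inverse:
  assumes "A \<in> Sp"
  shows "\<exists>B \<in> Sp. B ** A = mat 1 \<and> A ** B = mat 1"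
proof -
  have A: "omega (A *v x) (A *v y) = omega x y" for x y using assms by (simp add: Sp_def)
  have "x = 0" if "A *v x = 0" for x
  proof (rule nondegenerate_onD[OF omega_nondegenerate])
    show "omega x y = 0" for y using A[of x y] that by (simp add: omega.w_simps)
  qed simp
  then obtain B where BA: "B ** A = mat 1" by (metis matrix_left_invertible_ker)
  then have AB: "A ** B = mat 1" by (simp add: matrix_left_right_inverse)
  have "omega (B *v x) (B *v y) = omega x y" for x y
    using A[of "B *v x" "B *v y"] by (simp add: matrix_vector_mul_assoc AB)
  then show ?thesis using AB BA by (auto simp: Sp_def)
qed

theorem theorem2:
  fixes \<phi> :: "real ^ ('n::finite + 'n) ^ ('n + 'n)"
  assumes "\<phi> \<in> Sp"
  shows "\<exists>\<psi> \<in> Sp. \<psi> ** \<phi> ** matrix_inv \<psi> \<in> SpR"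
proof -
  obtain \<phi>' where \<phi>': "\<phi>' ** \<phi> = mat 1" "\<phi> ** \<phi>' = mat 1"
    using Sp_inverse[OF assms] by blast
  interpret symplectic_map omega "(*v) \<phi>" "(*v) \<phi>'"
    using assms
    by (intro symplectic_map.intro symplectic_map_axioms.intro alternating_form_omega)
      (auto simp: matrix_vector_mul_assoc \<phi>' Sp_def)
  have "reversible_on UNIV"
    by (rule nondegenerate_imp_reversible) (auto simp: invariant_def omega_nondegenerate)
  then obtain S where S: "linear S" "\<And>x. S (S x) = x" "\<And>x y. omega (S x) (S y) = - omega x y"
    and S\<phi>: "\<And>x. S (\<phi> *v x) = \<phi>' *v S x"
    unfolding reversible_on_def by blast
  obtain C where C: "C \<in> Sp" and CR: "\<And>x. C *v (Rmat *v x) = S (C *v x)"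
    using antisymplectic_involution_conj_Rmat[OF S] by blast
  obtain \<psi> where \<psi>: "\<psi> \<in> Sp" "\<psi> ** C = mat 1" "C ** \<psi> = mat 1"
    using Sp_inverse[OF C] by blast
  \<comment> \<open>This is \<open>\<phi>\<close> written in the Darboux basis, where
    \<open>S\<close> becomes \<open>Rmat\<close>.\<close>
  define M where "M = \<psi> ** \<phi> ** C"
  have CM: "C *v (M *v x) = \<phi> *v (C *v x)" for x
    by (simp add: M_def matrix_vector_mul_assoc matrix_mul_assoc \<psi>)
  have \<psi>C: "\<psi> *v (C *v x) = x" for x by (simp add: matrix_vector_mul_assoc \<psi>)
  have RR: "Rmat *v (Rmat *v x) = x" for x :: "real ^ ('n + 'n)"
  proof -
    have "C *v (Rmat *v (Rmat *v x)) = C *v x" by (simp only: CR S(2))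
    then have "\<psi> *v (C *v (Rmat *v (Rmat *v x))) = \<psi> *v (C *v x)" by (rule arg_cong)
    then show ?thesis by (simp only: \<psi>C)
  qed
  have "M \<in> Sp"
    using assms C \<psi>(1) by (auto simp: M_def Sp_def simp flip: matrix_vector_mul_assoc)
  moreover have "M = Rmat ** matrix_inv M ** Rmat"
  proof -
    \<comment> \<open>Transported by \<open>C\<close>, this says that \<open>S\<close> after
      \<open>\<phi>\<close> is an involution, which holds because \<open>S\<close> conjugates
      \<open>\<phi>\<close> to its inverse.\<close>
    have "Rmat *v (M *v (Rmat *v (M *v x))) = x" for x
    proof -
      have "C *v (Rmat *v (M *v (Rmat *v (M *v x)))) = C *v x"
        by (simp add: CR CM S\<phi> S(2))
      then have "\<psi> *v (C *v (Rmat *v (M *v (Rmat *v (M *v x))))) = \<psi> *v (C *v x)"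
        by (rule arg_cong)
      then show ?thesis by (simp only: \<psi>C)
    qed
    then have "matrix_inv M = Rmat ** M ** Rmat"
      by (intro matrix_inv_eqI) (simp add: matrix_eq flip: matrix_vector_mul_assoc)
    then show ?thesis by (simp add: matrix_eq RR flip: matrix_vector_mul_assoc)
  qed
  moreover have "matrix_inv \<psi> = C" by (rule matrix_inv_eqI) (rule \<psi>)
  ultimately show ?thesis using \<psi>(1) by (intro bexI[of _ \<psi>]) (simp_all add: SpR_def M_def)
qed

end
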